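(* Let $W$ be the complex Lie algebra with basis $\{L_m, I_m \mid m\in\mathbb{Z}\}$ and bracket $[L_m,L_n]=(m-n)L_{m+n}$, $[L_m,I_n]=(m-n)I_{m+n}$, $[I_m,I_n]=0$ for all $m,n\in\mathbb{Z}$. Let $\widetilde W$ be the complex Lie algebra with basis $\{L_n,I_n,C_1,C_2\mid n\in\mathbb{Z}\}$ and relations $$[L_m,L_n]=(m-n)L_{m+n}+\delta_{m+n,0}\frac{m^3-m}{12}C_1,\quad [L_m,I_n]=(m-n)I_{m+n}+\delta_{m+n,0}\frac{m^3-m}{12}C_2,$$ $$[I_m,I_n]=0,\quad [C_1,\widetilde W]=[C_2,\widetilde W]=0$$ for all $m,n\in\mathbb{Z}$. Then $\widetilde W$, together with the projection $\pi:\widetilde W\to W$ given by $L_n\mapsto L_n$, $I_n\mapsto I_n$, $C_1,C_2\mapsto 0$, is a universal central extension of $W$.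
   Context: A central extension of a Lie algebra $\mathfrak g$ is a pair $(\widetilde{\mathfrak g},\pi)$ where $\pi:\widetilde{\mathfrak g}\to\mathfrak g$ is a surjective Lie algebra homomorphism whose kernel lies in the center of $\widetilde{\mathfrak g}$. It is a covering if $\widetilde{\mathfrak g}$ is perfect, i.e. $[\widetilde{\mathfrak g},\widetilde{\mathfrak g}]=\widetilde{\mathfrak g}$. A covering $(\widetilde{\mathfrak g},\pi)$ is a universal central extension of $\mathfrak g$ if for every central extension $(\widetilde{\mathfrak g}',\varphi)$ of $\mathfrak g$ there is a unique Lie algebra homomorphism $\psi:\widetilde{\mathfrak g}\to\widetilde{\mathfrak g}'$ with $\varphi\psi=\pi$. *)

theory Defs
  imports Complex_Main "HOL-Library.Poly_Mapping"
begin

section \<open>Lie algebras and their central extensions\<close>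

locale lie_algebra = vector_space scale
  for scale :: "'k::field \<Rightarrow> 'a::ab_group_add \<Rightarrow> 'a" +
  fixes br :: "'a \<Rightarrow> 'a \<Rightarrow> 'a"
  assumes br_add_left: "br (x + y) z = br x z + br y z"
    and br_add_right: "br x (y + z) = br x y + br x z"
    and br_scale_left: "br (scale c x) y = scale c (br x y)"
    and br_scale_right: "br x (scale c y) = scale c (br x y)"
    and br_self: "br x x = 0"
    and jacobi: "br x (br y z) + br y (br z x) + br z (br x y) = 0"
begin

definition lie_center :: "'a set" where
  "lie_center = {z. \<forall>x. br z x = 0}"

definition lie_perfect :: bool where
  "lie_perfect \<longleftrightarrow> span {br x y | x y. True} = UNIV"

end

locale lie_algebra_hom =
  source: lie_algebra s1 b1 + target: lie_algebra s2 b2 + Vector_Spaces.linear s1 s2 f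
  for s1 :: "'k::field \<Rightarrow> 'a::ab_group_add \<Rightarrow> 'a" and b1
    and s2 :: "'k \<Rightarrow> 'b::ab_group_add \<Rightarrow> 'b" and b2
    and f :: "'a \<Rightarrow> 'b" +
  assumes hom_br: "f (b1 x y) = b2 (f x) (f y)"

locale lie_central_extension = lie_algebra_hom s1 b1 s2 b2 p
  for s1 :: "'k::field \<Rightarrow> 'a::ab_group_add \<Rightarrow> 'a" and b1
    and s2 :: "'k \<Rightarrow> 'b::ab_group_add \<Rightarrow> 'b" and b2
    and p :: "'a \<Rightarrow> 'b" +
  assumes surj: "surj p"
    and kernel_central: "{x. p x = 0} \<subseteq> source.lie_center"

locale lie_covering = lie_central_extension s1 b1 s2 b2 p
  for s1 :: "'k::field \<Rightarrow> 'a::ab_group_add \<Rightarrow> 'a" and b1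
    and s2 :: "'k \<Rightarrow> 'b::ab_group_add \<Rightarrow> 'b" and b2
    and p :: "'a \<Rightarrow> 'b" +
  assumes perfect: "source.lie_perfect"

text \<open>HOL formulas cannot quantify over types, so the type \<open>'e\<close> underlying the competing
  extensions is a parameter. Universality in the usual sense is this predicate for a type
  variable \<open>'e\<close>, which a theorem implicitly quantifies over.\<close>

definition universal_central_extension ::
    "'e::ab_group_add itself \<Rightarrow>
     ('k::field \<Rightarrow> 'a::ab_group_add \<Rightarrow> 'a) \<Rightarrow> ('a \<Rightarrow> 'a \<Rightarrow> 'a) \<Rightarrow>
     ('k \<Rightarrow> 'b::ab_group_add \<Rightarrow> 'b) \<Rightarrow> ('b \<Rightarrow> 'b \<Rightarrow> 'b) \<Rightarrow> ('a \<Rightarrow> 'b) \<Rightarrow> bool" where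
  "universal_central_extension (T :: 'e itself) s1 b1 s2 b2 p \<longleftrightarrow>
     lie_covering s1 b1 s2 b2 p \<and>
     (\<forall>(s' :: 'k \<Rightarrow> 'e \<Rightarrow> 'e) b' \<phi>.
        lie_central_extension s' b' s2 b2 \<phi> \<longrightarrow>
        (\<exists>!\<psi>. lie_algebra_hom s1 b1 s' b' \<psi> \<and> \<phi> \<circ> \<psi> = p))"


section \<open>Complex vector spaces with a prescribed basis\<close>

text \<open>The complex vector space with basis \<open>'b\<close> is \<open>'b \<Rightarrow>\<^sub>0 complex\<close>, the basis vector
  of \<open>a\<close> being \<open>Poly_Mapping.single a 1\<close>.\<close>

abbreviation basis_vec :: "'b \<Rightarrow> 'b \<Rightarrow>\<^sub>0 complex" where
  "basis_vec a \<equiv> Poly_Mapping.single a 1"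

definition fscale :: "complex \<Rightarrow> ('b \<Rightarrow>\<^sub>0 complex) \<Rightarrow> ('b \<Rightarrow>\<^sub>0 complex)" where
  "fscale c v = Poly_Mapping.map (\<lambda>x. c * x) v"

definition linear_ext ::
    "('b \<Rightarrow> ('c \<Rightarrow>\<^sub>0 complex)) \<Rightarrow> ('b \<Rightarrow>\<^sub>0 complex) \<Rightarrow> ('c \<Rightarrow>\<^sub>0 complex)" where
  "linear_ext h v = (\<Sum>a\<in>Poly_Mapping.keys v. fscale (Poly_Mapping.lookup v a) (h a))"

definition bilinear_ext ::
    "('b \<Rightarrow> 'b \<Rightarrow> ('c \<Rightarrow>\<^sub>0 complex)) \<Rightarrow>
     ('b \<Rightarrow>\<^sub>0 complex) \<Rightarrow> ('b \<Rightarrow>\<^sub>0 complex) \<Rightarrow> ('c \<Rightarrow>\<^sub>0 complex)" where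
  "bilinear_ext h v w = linear_ext (\<lambda>a. linear_ext (h a) w) v"

lemma fscale_one [simp]: "fscale 1 v = v"
  by (rule poly_mapping_eqI) (simp add: fscale_def map.rep_eq when_def)

lemma linear_ext_basis_vec [simp]: "linear_ext h (basis_vec a) = h a"
  by (simp add: linear_ext_def)

lemma bilinear_ext_basis_vec [simp]:
  "bilinear_ext h (basis_vec a) (basis_vec b) = h a b"
  by (simp add: bilinear_ext_def)


section \<open>The algebras \<open>W\<close> and \<open>W~\<close>\<close>

datatype W_basis = L int | I int

text \<open>The values on \<open>(I m, L n)\<close>, here and below, are those forced by antisymmetry.\<close>

fun W_br_basis :: "W_basis \<Rightarrow> W_basis \<Rightarrow> (W_basis \<Rightarrow>\<^sub>0 complex)" where
  "W_br_basis (L m) (L n) = fscale (of_int (m - n)) (basis_vec (L (m + n)))"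
| "W_br_basis (L m) (I n) = fscale (of_int (m - n)) (basis_vec (I (m + n)))"
| "W_br_basis (I m) (L n) = - fscale (of_int (n - m)) (basis_vec (I (n + m)))"
| "W_br_basis (I m) (I n) = 0"

definition W_br ::
    "(W_basis \<Rightarrow>\<^sub>0 complex) \<Rightarrow> (W_basis \<Rightarrow>\<^sub>0 complex) \<Rightarrow> (W_basis \<Rightarrow>\<^sub>0 complex)" where
  "W_br = bilinear_ext W_br_basis"

datatype Wt_basis = Lt int | It int | C1 | C2

definition central_coeff :: "int \<Rightarrow> int \<Rightarrow> complex" where
  "central_coeff m n = (if m + n = 0 then (of_int m ^ 3 - of_int m) / 12 else 0)"

fun Wt_br_basis :: "Wt_basis \<Rightarrow> Wt_basis \<Rightarrow> (Wt_basis \<Rightarrow>\<^sub>0 complex)" where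
  "Wt_br_basis (Lt m) (Lt n) =
     fscale (of_int (m - n)) (basis_vec (Lt (m + n))) + fscale (central_coeff m n) (basis_vec C1)"
| "Wt_br_basis (Lt m) (It n) =
     fscale (of_int (m - n)) (basis_vec (It (m + n))) + fscale (central_coeff m n) (basis_vec C2)"
| "Wt_br_basis (It m) (Lt n) =
     - (fscale (of_int (n - m)) (basis_vec (It (n + m))) + fscale (central_coeff n m) (basis_vec C2))"
| "Wt_br_basis (It m) (It n) = 0"
| "Wt_br_basis C1 _ = 0"
| "Wt_br_basis C2 _ = 0"
| "Wt_br_basis _ C1 = 0"
| "Wt_br_basis _ C2 = 0"

definition Wt_br ::
    "(Wt_basis \<Rightarrow>\<^sub>0 complex) \<Rightarrow> (Wt_basis \<Rightarrow>\<^sub>0 complex) \<Rightarrow> (Wt_basis \<Rightarrow>\<^sub>0 complex)" where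
  "Wt_br = bilinear_ext Wt_br_basis"

fun Wt_proj_basis :: "Wt_basis \<Rightarrow> (W_basis \<Rightarrow>\<^sub>0 complex)" where
  "Wt_proj_basis (Lt n) = basis_vec (L n)"
| "Wt_proj_basis (It n) = basis_vec (I n)"
| "Wt_proj_basis C1 = 0"
| "Wt_proj_basis C2 = 0"

definition Wt_proj :: "(Wt_basis \<Rightarrow>\<^sub>0 complex) \<Rightarrow> (W_basis \<Rightarrow>\<^sub>0 complex)" where
  "Wt_proj = linear_ext Wt_proj_basis"

end

theory Submission
  imports Defs
begin

text \<open>Any two lifts of an element to a central extension have the same brackets, so a map from the
  perfect algebra \<open>Wt\<close> lifting \<open>Wt_proj\<close> is determined on brackets, hence everywhere. For
  existence, take lifts of the \<open>L m\<close> and correct those with nonzero index so that \<open>L 0\<close> acts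
  diagonally. The Jacobi identity with \<open>L 0\<close> then removes every central term of
  \<open>[L m, L n]\<close> with \<open>m + n \<noteq> 0\<close>, and the remaining terms \<open>d m\<close> (for \<open>n = - m\<close>) satisfy a
  recursion that determines them from \<open>d 1\<close> and \<open>d 2\<close>; correcting \<open>L 0\<close> makes \<open>d 1 = 0\<close>, which
  leaves the multiples of \<open>m\<^sup>3 - m\<close>. The same argument applies to \<open>[L m, I n]\<close>, and the central
  bilinear form \<open>[I m, I n]\<close> vanishes because it is invariant under the \<open>L k\<close>.\<close>

section \<open>Linear extension from a basis\<close>

lemma lookup_fscale [simp]: "Poly_Mapping.lookup (fscale c v) a = c * Poly_Mapping.lookup v a"
  by (simp add: fscale_def map.rep_eq when_def)

interpretation fscale: vector_space fscale
  by unfold_locales (auto intro!: poly_mapping_eqI simp: lookup_add algebra_simps)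

lemma poly_mapping_eq_sum_basis_vec:
  "v = (\<Sum>a\<in>Poly_Mapping.keys v. fscale (Poly_Mapping.lookup v a) (basis_vec a))"
proof (rule poly_mapping_eqI)
  fix k
  have "Poly_Mapping.lookup (\<Sum>a\<in>Poly_Mapping.keys v. fscale (Poly_Mapping.lookup v a) (basis_vec a)) k
      = (\<Sum>a\<in>Poly_Mapping.keys v. if k = a then Poly_Mapping.lookup v a else 0)"
    unfolding lookup_sum by (intro sum.cong) (auto simp: lookup_single when_def)
  then show "Poly_Mapping.lookup v k = Poly_Mapping.lookup
      (\<Sum>a\<in>Poly_Mapping.keys v. fscale (Poly_Mapping.lookup v a) (basis_vec a)) k"
    by (simp add: in_keys_iff)
qed

lemma span_basis_vec: "fscale.span (range basis_vec) = UNIV"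
proof -
  have "v \<in> fscale.span (range basis_vec)" for v
    by (subst poly_mapping_eq_sum_basis_vec)
      (intro fscale.span_sum fscale.span_scale fscale.span_base rangeI)
  then show ?thesis by auto
qed

lemma basis_vec_induct [case_names basis zero add scale]:
  assumes "\<And>a. P (basis_vec a)" "P 0" "\<And>x y. P x \<Longrightarrow> P y \<Longrightarrow> P (x + y)"
    "\<And>c x. P x \<Longrightarrow> P (fscale c x)"
  shows "P v"
proof -
  have "v \<in> fscale.span (range basis_vec)"
    by (simp add: span_basis_vec)
  then show ?thesis
    by (rule fscale.span_induct_alt) (use assms in auto)
qed

text \<open>Allows an arbitrary complex vector space as target, given by its scaling
  \<open>s\<close>; \<open>linear_ext\<close> reaches only free ones, whereas a competing central
  extension need not come with a basis.\<close>

definition lin_ext ::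
    "(complex \<Rightarrow> 'e::ab_group_add \<Rightarrow> 'e) \<Rightarrow> ('b \<Rightarrow> 'e) \<Rightarrow> ('b \<Rightarrow>\<^sub>0 complex) \<Rightarrow> 'e" where
  "lin_ext s h v = (\<Sum>a\<in>Poly_Mapping.keys v. s (Poly_Mapping.lookup v a) (h a))"

lemma linear_ext_eq_lin_ext: "linear_ext = lin_ext fscale"
  by (intro ext) (simp add: linear_ext_def lin_ext_def)

text \<open>Lets vectors with different supports be summed over one common index set, which makes
  additivity of \<open>lin_ext\<close> a termwise identity.\<close>

lemma lin_ext_eq_sum:
  assumes "vector_space s" "finite A" "Poly_Mapping.keys v \<subseteq> A"
  shows "lin_ext s h v = (\<Sum>a\<in>A. s (Poly_Mapping.lookup v a) (h a))"
proof -
  interpret vector_space s by fact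
  show ?thesis
    unfolding lin_ext_def
    by (intro sum.mono_neutral_left assms) (auto simp: in_keys_iff)
qed

lemma linear_lin_ext:
  assumes "vector_space s"
  shows "Vector_Spaces.linear fscale s (lin_ext s h)"
proof -
  interpret vector_space s by fact
  have "lin_ext s h (v + w) = lin_ext s h v + lin_ext s h w" for v w
  proof -
    let ?A = "Poly_Mapping.keys v \<union> Poly_Mapping.keys w"
    note eq = lin_ext_eq_sum[OF assms, where A = ?A and h = h]
    show ?thesis
      using keys_add[of v w]
      by (subst (1 2 3) eq) (auto simp: lookup_add scale_left_distrib sum.distrib)
  qed
  moreover have "lin_ext s h (fscale c v) = s c (lin_ext s h v)" for c v
    by (subst (1 2) lin_ext_eq_sum[OF assms, where A = "Poly_Mapping.keys v"])
      (auto simp: in_keys_iff scale_sum_right)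
  ultimately show ?thesis
    using assms fscale.vector_space_axioms by (simp add: Vector_Spaces.linear_iff)
qed

lemma lin_ext_basis_vec [simp]:
  assumes "vector_space s"
  shows "lin_ext s h (basis_vec a) = h a"
proof -
  interpret vector_space s by fact
  show ?thesis by (simp add: lin_ext_def)
qed

lemma linear_linear_ext: "Vector_Spaces.linear fscale fscale (linear_ext h)"
  unfolding linear_ext_eq_lin_ext by (rule linear_lin_ext) unfold_locales

lemma linear_ext_add: "linear_ext h (v + w) = linear_ext h v + linear_ext h w"
  and linear_ext_fscale: "linear_ext h (fscale c v) = fscale c (linear_ext h v)"
  using linear_linear_ext[of h] by (auto simp: Vector_Spaces.linear_iff)

lemma bilinear_ext_add_left: "bilinear_ext h (u + v) w = bilinear_ext h u w + bilinear_ext h v w"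
  and bilinear_ext_fscale_left: "bilinear_ext h (fscale c v) w = fscale c (bilinear_ext h v w)"
  by (simp_all add: bilinear_ext_def linear_ext_add linear_ext_fscale)

lemma bilinear_ext_add_right: "bilinear_ext h u (v + w) = bilinear_ext h u v + bilinear_ext h u w"
  by (simp add: bilinear_ext_def linear_ext_add)
    (simp add: linear_ext_def fscale.scale_right_distrib sum.distrib)

lemma bilinear_ext_fscale_right: "bilinear_ext h v (fscale c w) = fscale c (bilinear_ext h v w)"
  by (simp add: bilinear_ext_def linear_ext_fscale)
    (simp add: linear_ext_def fscale.scale_sum_right mult.left_commute)

lemma bilinear_ext_zero_left: "bilinear_ext h 0 w = 0"
  and bilinear_ext_zero_right: "bilinear_ext h v 0 = 0"
  using bilinear_ext_fscale_left[of h 0 0 w] bilinear_ext_fscale_right[of h v 0 0] by simp_all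

lemma bilinear_ext_minus_right: "bilinear_ext h v (- w) = - bilinear_ext h v w"
  using bilinear_ext_fscale_right[of h v "- 1" w] by simp

lemma linear_eq_basis_vec:
  assumes "Vector_Spaces.linear fscale s f" "Vector_Spaces.linear fscale s g"
    and "\<And>a. f (basis_vec a) = g (basis_vec a)"
  shows "f = g"
proof -
  interpret f: Vector_Spaces.linear fscale s f by fact
  interpret g: Vector_Spaces.linear fscale s g by fact
  have "f v = g v" for v
    by (induction v rule: basis_vec_induct)
      (simp_all add: assms f.add g.add f.scale g.scale f.zero g.zero)
  then show ?thesis by blast
qed


section \<open>Lie algebras\<close>

context lie_algebra
begin

lemma br_zero_left [simp]: "br 0 x = 0"
  using br_add_left[of 0 0 x] by simp

lemma br_zero_right [simp]: "br x 0 = 0"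
  using br_add_right[of x 0 0] by simp

lemma br_minus_left: "br (- x) y = - br x y"
  using br_add_left[of x "- x" y] by (simp add: eq_neg_iff_add_eq_0 add.commute)

lemma br_minus_right: "br x (- y) = - br x y"
  using br_add_right[of x y "- y"] by (simp add: eq_neg_iff_add_eq_0 add.commute)

lemma br_diff_left: "br (x - y) z = br x z - br y z"
  using br_add_left[of x "- y" z] by (simp add: br_minus_left)

lemma br_diff_right: "br x (y - z) = br x y - br x z"
  using br_add_right[of x y "- z"] by (simp add: br_minus_right)

lemma br_antisym: "br x y = - br y x"
proof -
  have "br x y + br y x = br (x + y) (x + y)"
    by (simp add: br_add_left br_add_right br_self[of x] br_self[of y] add.commute)
  also have "\<dots> = 0" by (rule br_self)
  finally show ?thesis by (simp only: eq_neg_iff_add_eq_0)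
qed

lemma br_leibniz: "br x (br y z) = br (br x y) z + br y (br x z)"
  using jacobi[of x y z] br_antisym[of z "br x y"] br_antisym[of z x]
  by (simp add: br_minus_right algebra_simps)

lemma lie_center_br_left: "z \<in> lie_center \<Longrightarrow> br z x = 0"
  by (simp add: lie_center_def)

lemma lie_center_br_right: "z \<in> lie_center \<Longrightarrow> br x z = 0"
  using br_antisym[of x z] by (simp add: lie_center_def)

lemma br_cong_left: "x - y \<in> lie_center \<Longrightarrow> br x z = br y z"
  using lie_center_br_left[of "x - y" z] by (simp add: br_diff_left)

lemma br_cong_right: "x - y \<in> lie_center \<Longrightarrow> br z x = br z y"
  using lie_center_br_right[of "x - y" z] by (simp add: br_diff_right)

end

text \<open>Two lifts differ by central elements, which brackets do not see, so they agree on all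
  brackets; by perfectness these span the source.\<close>

lemma lie_algebra_hom_unique:
  assumes "lie_algebra.lie_perfect s br"
    and "lie_central_extension s' br' s2 b2 \<phi>"
    and "lie_algebra_hom s br s' br' \<psi>" "lie_algebra_hom s br s' br' \<chi>"
    and "\<phi> \<circ> \<psi> = \<phi> \<circ> \<chi>"
  shows "\<psi> = \<chi>"
proof
  fix x
  interpret \<phi>: lie_central_extension s' br' s2 b2 \<phi> by fact
  interpret \<psi>: lie_algebra_hom s br s' br' \<psi> by fact
  interpret \<chi>: lie_algebra_hom s br s' br' \<chi> by fact
  interpret vector_space_pair s s' ..
  have central: "\<psi> y - \<chi> y \<in> \<phi>.source.lie_center" for y
    using fun_cong[OF assms(5), of y] \<phi>.kernel_central by (auto simp: \<phi>.diff)
  have "\<psi> (br y z) = \<chi> (br y z)" for y z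
    by (simp add: \<psi>.hom_br \<chi>.hom_br \<phi>.source.br_cong_left[OF central]
        \<phi>.source.br_cong_right[OF central])
  then show "\<psi> x = \<chi> x"
    using assms(1) linear_eq_on[OF \<psi>.linear_axioms \<chi>.linear_axioms,
        where B = "{br y z | y z. True}" and x = x]
    by (auto simp: \<psi>.source.lie_perfect_def)
qed


section \<open>Lifting Witt relations to a central extension\<close>

text \<open>Stated for a second family \<open>y\<close> so that it serves both for
  \<open>[L, L]\<close> (with \<open>y = x\<close>) and for \<open>[L, I]\<close>. Tracking a
  subspace \<open>K\<close> of the center, later the kernel of the extension, ensures that the
  corrections and \<open>c\<close> are invisible after projection.\<close>

lemma witt_module_lift:
  fixes s :: "complex \<Rightarrow> 'e::ab_group_add \<Rightarrow> 'e" and x y :: "int \<Rightarrow> 'e"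
  assumes "lie_algebra s br"
    and K: "module.subspace s K" "K \<subseteq> lie_algebra.lie_center br"
    and x: "\<And>m n. br (x m) (x n) - s (of_int (m - n)) (x (m + n)) \<in> K"
    and y: "\<And>m n. br (x m) (y n) - s (of_int (m - n)) (y (m + n)) \<in> K"
  obtains J c where "\<And>m. J m - y m \<in> K"
    and "c \<in> K"
    and "\<And>m n. br (x m) (J n) = s (of_int (m - n)) (J (m + n)) + s (central_coeff m n) c"
proof -
  interpret lie_algebra s br by fact
  \<comment> \<open>For nonzero \<open>m\<close> this makes \<open>J m\<close> an eigenvector of
    \<open>x 0\<close>. The value at \<open>0\<close> is chosen so that
    \<open>[x 1, J (-1)] = 2 J 0\<close> holds exactly, which later gives
    \<open>d 1 = 0\<close>.\<close>
  define J where "J m = (if m = 0 then s (1/2) (br (x 1) (y (- 1)))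
      else s (- 1 / of_int m) (br (x 0) (y m)))" for m
  have J: "J m - y m \<in> K" for m
  proof (cases "m = 0")
    case True
    then have "J m - y m = s (1/2) (br (x 1) (y (- 1)) - s (of_int (1 - - 1)) (y (1 + - 1)))"
      by (simp add: J_def scale_right_diff_distrib)
    then show ?thesis using subspace_scale[OF K(1) y] by metis
  next
    case False
    then have "J m - y m = s (- 1 / of_int m) (br (x 0) (y m) - s (of_int (0 - m)) (y (0 + m)))"
      by (simp add: J_def scale_right_distrib)
    then show ?thesis using subspace_scale[OF K(1) y] by metis
  qed
  note br_J = br_cong_right[OF subsetD[OF K(2) J]]
  have xx: "br (br (x m) (x n)) b = s (of_int (m - n)) (br (x (m + n)) b)" for m n b
    using br_cong_left[OF subsetD[OF K(2) x]] by (simp add: br_scale_left)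
  have xy: "br b (br (x m) (y n)) = s (of_int (m - n)) (br b (y (m + n)))" for m n b
    using br_cong_right[OF subsetD[OF K(2) y]] by (simp add: br_scale_right)
  have x0: "br (x 0) (J m) = s (- of_int m) (J m)" for m
  proof (cases "m = 0")
    case True
    \<comment> \<open>By the Leibniz rule, \<open>x 0\<close> acts on the two factors with the
      opposite weights -1 and 1.\<close>
    have "br (x 0) (br (x 1) (y (- 1))) = 0"
      by (subst br_leibniz) (simp add: xx xy)
    with True show ?thesis by (simp add: J_def br_scale_right)
  next
    case False
    then show ?thesis by (simp add: br_J) (simp add: J_def)
  qed
  have off: "br (x m) (J n) = s (of_int (m - n)) (J (m + n))" if "m + n \<noteq> 0" for m n
  proof -
    \<comment> \<open>Evaluate \<open>[x 0, [x m, J n]]\<close> twice: replacing the inner bracket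
      modulo the center, and by the Leibniz rule. Both give weight \<open>-(m + n)\<close>, which
      can be cancelled.\<close>
    have "s (- of_int (m + n)) (s (of_int (m - n)) (J (m + n))) = br (x 0) (br (x m) (J n))"
      using x0[of "m + n"] by (simp add: br_J xy mult.commute)
    also have "\<dots> = s (- of_int (m + n)) (br (x m) (J n))"
      unfolding br_leibniz[of "x 0" "x m"] xx x0 br_scale_right
      by (simp add: scale_left_diff_distrib)
    finally show ?thesis
      using that by (simp only: scale_cancel_left) (simp flip: of_int_add)
  qed
  \<comment> \<open>The central defect on the antidiagonal \<open>n = - m\<close>, the only place
    left where one can occur.\<close>
  define d where "d m = br (x m) (J (- m)) - s (of_int (2 * m)) (J 0)" for m
  have d_central: "d m \<in> K" for m
  proof -
    have "d m = (br (x m) (y (- m)) - s (of_int (m - - m)) (y (m + - m))) - s (of_int (2 * m)) (J 0 - y 0)"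
      by (simp add: d_def br_J scale_right_diff_distrib)
    then show ?thesis
      using subspace_diff[OF K(1) y subspace_scale[OF K(1) J]] by metis
  qed
  \<comment> \<open>The Leibniz rule for \<open>x m\<close>, \<open>x n\<close>, \<open>J k\<close>
    with \<open>m + n + k = 0\<close>; the multiples of \<open>J 0\<close> cancel.\<close>
  have cocycle: "s (of_int (m + 2 * n)) (d m) - s (of_int (2 * m + n)) (d n)
      = s (of_int (m - n)) (d (m + n))" for m n
  proof -
    define k where "k = - m - n"
    have "br (x m) (br (x n) (J k)) = br (br (x m) (x n)) (J k) + br (x n) (br (x m) (J k))"
      by (rule br_leibniz)
    then have "s (of_int (n - k)) (br (x m) (J (- m)))
        = s (of_int (m - n)) (br (x (m + n)) (J (- (m + n))))
        + s (of_int (m - k)) (br (x n) (J (- n)))"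
      by (simp add: br_J xx xy k_def)
    then show ?thesis
      by (simp add: d_def k_def algebra_simps)
  qed
  \<comment> \<open>The factor 2 inverts \<open>(2^3 - 2) / 12 = 1/2\<close>.\<close>
  define c where "c = s 2 (d 2)"
  have d0: "d 0 = 0" using cocycle[of 1 0] by simp
  have d1: "d 1 = 0"
    by (simp add: d_def br_J) (simp add: J_def)
  have odd: "d (- m) = - d m" for m
  proof (cases "m = 0")
    case False
    \<comment> \<open>For \<open>n = - m\<close> the right-hand side of \<open>cocycle\<close> is a
      multiple of \<open>d 0 = 0\<close>.\<close>
    have "s (of_int m) (d m + d (- m)) = 0"
      using cocycle[of m "- m"] d0 by (simp add: scale_right_distrib) (metis neg_eq_iff_add_eq_0)
    with False show ?thesis by (simp add: eq_neg_iff_add_eq_0 add.commute)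
  qed (simp add: d0)
  have pos: "d (int n) = s ((of_nat n ^ 3 - of_nat n) / 12) c" for n
  proof (induction n)
    case 0
    then show ?case by (simp add: d0)
  next
    case (Suc n)
    \<comment> \<open>The recursion \<open>(n - 1) d (n + 1) = (n + 2) d n\<close> degenerates at
      \<open>n = 1\<close>, so \<open>d 2\<close> is a free parameter, absorbed into
      \<open>c\<close>. From there on it is solved by multiples of
      \<open>n^3 - n = (n - 1) n (n + 1)\<close>.\<close>
    consider "n = 0" | "n = 1" | "n \<ge> 2" by linarith
    then show ?case
    proof cases
      case 1
      then show ?thesis by (simp add: d1)
    next
      case 2
      then show ?thesis by (simp add: c_def)
    next
      case 3
      have "s (of_nat n - 1) (d (int (Suc n))) = s (of_nat n + 2) (d (int n))"
        using cocycle[of "int n" 1] by (simp add: d1 add.commute)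
      also have "\<dots> = s (of_nat n - 1) (s ((of_nat (Suc n) ^ 3 - of_nat (Suc n)) / 12) c)"
        unfolding Suc.IH by (simp add: field_simps power3_eq_cube)
      finally show ?thesis using 3 by (simp only: scale_cancel_left) auto
    qed
  qed
  have d: "d m = s ((of_int m ^ 3 - of_int m) / 12) c" for m
  proof (cases "m \<ge> 0")
    case True
    then show ?thesis using pos[of "nat m"] by simp
  next
    case False
    then show ?thesis
      using pos[of "nat (- m)"] odd[of "- m"] by (simp add: diff_divide_distrib scale_left_diff_distrib)
  qed
  have diag: "br (x m) (J n) = s (of_int (m - n)) (J (m + n)) + s (central_coeff m n) c"
    if "m + n = 0" for m n
  proof -
    from that have "n = - m" by simp
    then show ?thesis using d[of m] by (simp add: d_def central_coeff_def algebra_simps)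
  qed
  show thesis
  proof (rule that[OF J])
    show "c \<in> K" unfolding c_def by (intro subspace_scale K(1) d_central)
    show "br (x m) (J n) = s (of_int (m - n)) (J (m + n)) + s (central_coeff m n) c" for m n
      using off[of m n] diag[of m n] by (cases "m + n = 0") (simp_all add: central_coeff_def)
  qed
qed

text \<open>Since \<open>[y p, y q]\<close> is central, bracketing it with \<open>x k\<close> gives
  0, and the Leibniz rule turns this into an invariance relation. Taking \<open>k = 0\<close> kills
  all values with nonzero index sum; \<open>k = - m\<close> reduces \<open>[y m, y (- m)]\<close> to
  \<open>[y 0, y 0] = 0\<close>.\<close>

lemma witt_module_lift_abelian:
  fixes s :: "complex \<Rightarrow> 'e::ab_group_add \<Rightarrow> 'e" and x y :: "int \<Rightarrow> 'e"
  assumes "lie_algebra s br"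
    and y: "\<And>m n. br (x m) (y n) - s (of_int (m - n)) (y (m + n)) \<in> lie_algebra.lie_center br"
    and yy: "\<And>m n. br (y m) (y n) \<in> lie_algebra.lie_center br"
  shows "br (y m) (y n) = 0"
proof -
  interpret lie_algebra s br by fact
  have xy: "br b (br (x m) (y n)) = s (of_int (m - n)) (br b (y (m + n)))"
    "br (br (x m) (y n)) b = s (of_int (m - n)) (br (y (m + n)) b)" for m n b
    using br_cong_right[OF y] br_cong_left[OF y] by (simp_all add: br_scale_right br_scale_left)
  have inv: "s (of_int (k - p)) (br (y (k + p)) (y q)) + s (of_int (k - q)) (br (y p) (y (k + q))) = 0"
    for k p q
    using br_leibniz[of "x k" "y p" "y q"] lie_center_br_right[OF yy] by (simp add: xy)
  show ?thesis
  proof (cases "m + n = 0")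
    case False
    have "s (- of_int (m + n)) (br (y m) (y n)) = 0"
      using inv[of 0 m n] by (simp add: scale_left_diff_distrib)
    moreover have "(- of_int (m + n) :: complex) \<noteq> 0"
      using False by (simp flip: of_int_add)
    ultimately show ?thesis by (simp only: scale_eq_0_iff) simp
  next
    case True
    then show ?thesis
      using inv[of "- m" m 0] by (cases "m = 0") (auto simp: br_self add_eq_0_iff)
  qed
qed


section \<open>The central extension \<open>Wt_proj\<close>\<close>

lemma lie_algebra_bilinear_ext:
  assumes antisym: "\<And>a b. h a b = - h b a"
    and jacobi: "\<And>a b c. bilinear_ext h (basis_vec a) (h b c) + bilinear_ext h (basis_vec b) (h c a)
      + bilinear_ext h (basis_vec c) (h a b) = 0"
  shows "lie_algebra fscale (bilinear_ext h)"
proof -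
  let ?br = "bilinear_ext h"
  note bilinear = bilinear_ext_add_left bilinear_ext_add_right
    bilinear_ext_fscale_left bilinear_ext_fscale_right
  note zero = bilinear_ext_zero_left bilinear_ext_zero_right
  have skew: "?br x y + ?br y x = 0" for x y
  proof (induction x rule: basis_vec_induct)
    case (basis a)
    show ?case
    proof (induction y rule: basis_vec_induct)
      case (basis b)
      show ?case using antisym[of a b] by simp
    qed (simp_all add: zero bilinear add.assoc add.left_commute flip: fscale.scale_right_distrib,
        simp_all add: add_eq_0_iff)
  qed (simp_all add: zero bilinear algebra_simps flip: fscale.scale_right_distrib)
  \<comment> \<open>The Jacobi sum is invariant under rotation, so linearity in the first argument
    suffices: each argument is rotated to the front and reduced to basis vectors.\<close>
  define jac where "jac x y z = ?br x (?br y z) + ?br y (?br z x) + ?br z (?br x y)" for x y z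
  have jac_add: "jac (x + x') y z = jac x y z + jac x' y z"
    and jac_scale: "jac (fscale c x) y z = fscale c (jac x y z)"
    and jac_zero: "jac 0 y z = 0"
    and jac_cyclic: "jac x y z = jac y z x" for c x x' y z
    by (simp_all add: jac_def bilinear zero fscale.scale_right_distrib add_ac)
  note jac_linear = jac_add jac_scale jac_zero
  have jac1: "jac (basis_vec a) (basis_vec b) z = 0" for a b z
    by (subst jac_cyclic, subst jac_cyclic, induction z rule: basis_vec_induct)
      (simp_all add: jac_linear, simp add: jac_def jacobi)
  have jac2: "jac (basis_vec a) y z = 0" for a y z
    by (subst jac_cyclic, induction y rule: basis_vec_induct)
      (simp_all add: jac_linear, metis jac1 jac_cyclic)
  have jac3: "jac x y z = 0" for x y z
    by (induction x rule: basis_vec_induct) (simp_all add: jac_linear jac2)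
  show ?thesis
  proof unfold_locales
    show "?br x x = 0" for x
    proof -
      \<comment> \<open>Skew symmetry gives \<open>[x, x] = 0\<close> because 2 is
        invertible.\<close>
      have "fscale 2 (?br x x) = ?br x x + ?br x x"
        using fscale.scale_left_distrib[of 1 1 "?br x x"] by simp
      then show ?thesis by (simp add: skew)
    qed
    show "?br x (?br y z) + ?br y (?br z x) + ?br z (?br x y) = 0" for x y z
      using jac3[of x y z] by (simp add: jac_def)
  qed (simp_all add: bilinear)
qed

section \<open>The Lie algebra structure of \<open>Wt\<close>\<close>

lemma central_coeff_antisym: "central_coeff m n = - central_coeff n m"
proof (cases "m + n = 0")
  case True
  then have "n = - m" by simp
  then show ?thesis by (simp add: central_coeff_def field_simps)
qed (simp add: central_coeff_def add.commute)

text \<open>This is the central component of the Jacobi identity. Every term contains the same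
  condition \<open>m + n + k = 0\<close>; under it the claim is a polynomial identity.\<close>

lemma central_coeff_cocycle:
  "of_int (n - k) * central_coeff m (n + k) + of_int (k - m) * central_coeff n (k + m)
    + of_int (m - n) * central_coeff k (m + n) = 0"
proof (cases "m + n + k = 0")
  case True
  then have k: "k = - m - n" by simp
  show ?thesis unfolding k by (simp add: central_coeff_def field_simps power3_eq_cube)
qed (simp add: central_coeff_def add_ac)

text \<open>Jacobi terms vanish individually on triples with a central vector or at least two
  \<open>It\<close>. In the other triples the noncentral coefficient is \<open>linear_part\<close>
  and the central one is \<open>central_coeff_cocycle\<close>, with \<open>C2\<close> replacing
  \<open>C1\<close> once an \<open>It\<close> is present.\<close>

lemma lie_algebra_Wt: "lie_algebra fscale Wt_br"
  unfolding Wt_br_def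
proof (rule lie_algebra_bilinear_ext)
  show "Wt_br_basis a b = - Wt_br_basis b a" for a b
  proof -
    have "Wt_br_basis (Lt m) (Lt n) = - Wt_br_basis (Lt n) (Lt m)" for m n
      using central_coeff_antisym[of m n]
      by (simp add: add.commute fscale.scale_left_diff_distrib)
    then show ?thesis
      by (cases a; cases b; (hypsubst, assumption | simp))
  qed
  show "bilinear_ext Wt_br_basis (basis_vec a) (Wt_br_basis b c)
      + bilinear_ext Wt_br_basis (basis_vec b) (Wt_br_basis c a)
      + bilinear_ext Wt_br_basis (basis_vec c) (Wt_br_basis a b) = 0" (is "?jac a b c = 0") for a b c
  proof -
    have minus: "bilinear_ext Wt_br_basis u (v - w)
        = bilinear_ext Wt_br_basis u v - bilinear_ext Wt_br_basis u w" for u v w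
      using bilinear_ext_add_right[of _ u v "- w"] by (simp add: bilinear_ext_minus_right)
    note bilinear = bilinear_ext_add_right bilinear_ext_fscale_right bilinear_ext_zero_right
      bilinear_ext_minus_right minus
    have linear_part: "of_int (n - k) * (of_int m - of_int (n + k))
        + of_int (k - m) * (of_int n - of_int (k + m))
        + of_int (m - n) * (of_int k - of_int (m + n)) = (0 :: complex)" for m n k
      by (simp add: algebra_simps)
    have LLL: "?jac (Lt m) (Lt n) (Lt k) = 0" for m n k
    proof -
      have "?jac (Lt m) (Lt n) (Lt k) =
          fscale (of_int (n - k) * (of_int m - of_int (n + k))
            + of_int (k - m) * (of_int n - of_int (k + m))
            + of_int (m - n) * (of_int k - of_int (m + n))) (basis_vec (Lt (m + n + k)))
        + fscale (of_int (n - k) * central_coeff m (n + k) + of_int (k - m) * central_coeff n (k + m)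
            + of_int (m - n) * central_coeff k (m + n)) (basis_vec C1)"
        by (simp add: bilinear algebra_simps)
      then show ?thesis by (simp only: linear_part central_coeff_cocycle) simp
    qed
    have LLI: "?jac (Lt m) (Lt n) (It k) = 0" for m n k
    proof -
      have "?jac (Lt m) (Lt n) (It k) =
          fscale (of_int (n - k) * (of_int m - of_int (n + k))
            + of_int (k - m) * (of_int n - of_int (k + m))
            + of_int (m - n) * (of_int k - of_int (m + n))) (basis_vec (It (m + n + k)))
        + fscale (of_int (n - k) * central_coeff m (n + k) + of_int (k - m) * central_coeff n (k + m)
            + of_int (m - n) * central_coeff k (m + n)) (basis_vec C2)"
        \<comment> \<open>In the third term \<open>It k\<close> stands on the left, so the bracket
          carries \<open>- central_coeff (m + n) k\<close>; antisymmetry restores the cocycle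
          form.\<close>
        by (simp add: bilinear central_coeff_antisym[of "m + n" k] algebra_simps)
      then show ?thesis by (simp only: linear_part central_coeff_cocycle) simp
    qed
    have ILL: "?jac (It k) (Lt m) (Lt n) = 0" for m n k
      using LLI[of m n k] by (simp only: add_ac)
    have LIL: "?jac (Lt m) (It k) (Lt n) = 0" for m n k
      using LLI[of n m k] by (simp only: add_ac)
    show ?thesis
      by (cases a; cases b; cases c; hypsubst) (rule LLL LLI ILL LIL | simp add: bilinear)+
  qed
qed

section \<open>The projection onto \<open>W\<close> as a covering\<close>

interpretation Wt: lie_algebra fscale Wt_br
  by (rule lie_algebra_Wt)

interpretation Wt_proj: Vector_Spaces.linear fscale fscale Wt_proj
  unfolding Wt_proj_def by (rule linear_linear_ext)

lemma Wt_proj_basis_vec [simp]: "Wt_proj (basis_vec a) = Wt_proj_basis a"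
  by (simp add: Wt_proj_def)

lemma Wt_br_basis_vec [simp]: "Wt_br (basis_vec a) (basis_vec b) = Wt_br_basis a b"
  by (simp add: Wt_br_def)

lemma W_br_basis_vec [simp]: "W_br (basis_vec a) (basis_vec b) = W_br_basis a b"
  by (simp add: W_br_def)

lemma W_br_bilinear:
  "W_br (x + y) z = W_br x z + W_br y z" "W_br x (y + z) = W_br x y + W_br x z"
  "W_br (fscale c x) y = fscale c (W_br x y)" "W_br x (fscale c y) = fscale c (W_br x y)"
  by (simp_all add: W_br_def bilinear_ext_add_left bilinear_ext_add_right
      bilinear_ext_fscale_left bilinear_ext_fscale_right)

lemma W_br_zero [simp]: "W_br 0 x = 0" "W_br x 0 = 0"
  using W_br_bilinear(3)[of 0 0 x] W_br_bilinear(4)[of x 0 0] by simp_all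

lemma Wt_proj_br: "Wt_proj (Wt_br x y) = W_br (Wt_proj x) (Wt_proj y)"
proof (induction x rule: basis_vec_induct)
  case (basis a)
  show ?case
  proof (induction y rule: basis_vec_induct)
    case (basis b)
    show ?case
      by (cases a; cases b) (simp_all add: Wt_proj.add Wt_proj.scale Wt_proj.neg Wt_proj.diff)
  qed (simp_all add: Wt.br_add_right Wt.br_scale_right Wt_proj.add Wt_proj.scale W_br_bilinear)
qed (simp_all add: Wt.br_add_left Wt.br_scale_left Wt_proj.add Wt_proj.scale W_br_bilinear)

lemma surj_Wt_proj: "surj Wt_proj"
proof -
  have "\<exists>x. v = Wt_proj x" for v
  proof (induction v rule: basis_vec_induct)
    case (basis a)
    have "basis_vec a = Wt_proj (basis_vec (case a of L n \<Rightarrow> Lt n | I n \<Rightarrow> It n))"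
      by (simp split: W_basis.split)
    then show ?case by blast
  qed (metis Wt_proj.zero Wt_proj.add Wt_proj.scale)+
  then show ?thesis by (simp add: surj_def)
qed

text \<open>The identities are inherited from \<open>Wt\<close>: \<open>q\<close> picks preimages
  under the surjective, bracket-preserving \<open>Wt_proj\<close>.\<close>

lemma lie_algebra_W: "lie_algebra fscale W_br"
proof
  have "\<exists>x. v = Wt_proj x" for v
    using surj_Wt_proj by (simp add: surj_def)
  then obtain q where q: "\<And>v. v = Wt_proj (q v)" by metis
  show "W_br x x = 0" for x
    using Wt_proj_br[of "q x" "q x"] by (simp add: Wt.br_self flip: q)
  show "W_br x (W_br y z) + W_br y (W_br z x) + W_br z (W_br x y) = 0" for x y z
  proof -
    have "Wt_proj (Wt_br (q x) (Wt_br (q y) (q z)) + Wt_br (q y) (Wt_br (q z) (q x))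
        + Wt_br (q z) (Wt_br (q x) (q y))) = 0"
      by (simp add: Wt.jacobi)
    then show ?thesis by (simp add: Wt_proj.add Wt_proj_br flip: q)
  qed
qed (simp_all add: W_br_bilinear)

lemma lookup_Wt_proj:
  "Poly_Mapping.lookup (Wt_proj x) (L n) = Poly_Mapping.lookup x (Lt n)"
  "Poly_Mapping.lookup (Wt_proj x) (I n) = Poly_Mapping.lookup x (It n)"
proof (induction x rule: basis_vec_induct)
  case (basis a)
  {
    case 1
    then show ?case by (cases a) (simp_all add: lookup_single when_def)
  next
    case 2
    then show ?case by (cases a) (simp_all add: lookup_single when_def)
  }
qed (simp_all add: Wt_proj.add Wt_proj.scale lookup_add)

lemma Wt_br_C:
  "Wt_br (basis_vec C1) y = 0" "Wt_br (basis_vec C2) y = 0"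
  by (induction y rule: basis_vec_induct) (simp_all add: Wt.br_add_right Wt.br_scale_right)

lemma Wt_proj_kernel_central: "{x. Wt_proj x = 0} \<subseteq> Wt.lie_center"
proof
  fix x assume "x \<in> {x. Wt_proj x = 0}"
  then have zero: "Poly_Mapping.lookup x (Lt n) = 0" "Poly_Mapping.lookup x (It n) = 0" for n
    by (simp_all flip: lookup_Wt_proj)
  \<comment> \<open>\<open>Wt_proj\<close> preserves the \<open>Lt\<close> and \<open>It\<close>
    coordinates, so only the two central ones survive in its kernel.\<close>
  have "x = fscale (Poly_Mapping.lookup x C1) (basis_vec C1)
      + fscale (Poly_Mapping.lookup x C2) (basis_vec C2)"
  proof (rule poly_mapping_eqI)
    fix k
    show "Poly_Mapping.lookup x k = Poly_Mapping.lookup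
      (fscale (Poly_Mapping.lookup x C1) (basis_vec C1)
        + fscale (Poly_Mapping.lookup x C2) (basis_vec C2)) k"
      by (cases k) (simp_all add: zero lookup_add lookup_single when_def)
  qed
  then have "Wt_br x y = 0" for y
    by (metis Wt.br_add_left Wt.br_scale_left Wt_br_C fscale.scale_zero_right add_0_left)
  then show "x \<in> Wt.lie_center" by (simp add: Wt.lie_center_def)
qed

lemma Wt_perfect: "Wt.lie_perfect"
proof -
  let ?S = "fscale.span {Wt_br x y | x y. True}"
  have br: "Wt_br x y \<in> ?S" for x y
    by (rule fscale.span_base) blast
  have Lt: "basis_vec (Lt m) \<in> ?S" for m
  proof (cases "m = 0")
    case True
    \<comment> \<open>\<open>central_coeff 1 (-1) = 0\<close>, so this bracket has no central
      term.\<close>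
    then have "basis_vec (Lt m) = fscale (1/2) (Wt_br (basis_vec (Lt 1)) (basis_vec (Lt (- 1))))"
      by (simp add: central_coeff_def)
    also have "\<dots> \<in> ?S" by (intro fscale.span_scale br)
    finally show ?thesis .
  next
    case False
    then have "basis_vec (Lt m) = fscale (1 / of_int m) (Wt_br (basis_vec (Lt m)) (basis_vec (Lt 0)))"
      by (simp add: central_coeff_def)
    also have "\<dots> \<in> ?S" by (intro fscale.span_scale br)
    finally show ?thesis .
  qed
  have It: "basis_vec (It m) \<in> ?S" for m
  proof (cases "m = 0")
    case True
    then have "basis_vec (It m) = fscale (1/2) (Wt_br (basis_vec (Lt 1)) (basis_vec (It (- 1))))"
      by (simp add: central_coeff_def)
    also have "\<dots> \<in> ?S" by (intro fscale.span_scale br)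
    finally show ?thesis .
  next
    case False
    then have "basis_vec (It m) = fscale (1 / of_int m) (Wt_br (basis_vec (Lt m)) (basis_vec (It 0)))"
      by (simp add: central_coeff_def)
    also have "\<dots> \<in> ?S" by (intro fscale.span_scale br)
    finally show ?thesis .
  qed
  \<comment> \<open>Index 2 is the first with a central term:
    \<open>[L 2, L (-2)] = 4 L 0 + C1 / 2\<close>, and likewise for \<open>C2\<close>.\<close>
  have C_eq: "basis_vec C1 = fscale 2 (Wt_br (basis_vec (Lt 2)) (basis_vec (Lt (- 2))) - fscale 4 (basis_vec (Lt 0)))"
    "basis_vec C2 = fscale 2 (Wt_br (basis_vec (Lt 2)) (basis_vec (It (- 2))) - fscale 4 (basis_vec (It 0)))"
    by (simp_all add: central_coeff_def)
  have C: "basis_vec C1 \<in> ?S" "basis_vec C2 \<in> ?S"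
    unfolding C_eq by (intro fscale.span_scale fscale.span_diff br Lt It)+
  have "v \<in> ?S" for v
  proof (induction v rule: basis_vec_induct)
    case (basis a)
    show ?case by (cases a) (simp_all only: Lt It C)
  qed (auto intro: fscale.span_zero fscale.span_add fscale.span_scale)
  then show ?thesis by (auto simp: Wt.lie_perfect_def)
qed

lemma lie_covering_Wt_proj: "lie_covering fscale Wt_br fscale W_br Wt_proj"
proof -
  interpret W: lie_algebra fscale W_br by (rule lie_algebra_W)
  show ?thesis
    by unfold_locales
      (rule Wt_proj_br surj_Wt_proj Wt_proj_kernel_central Wt_perfect)+
qed

section \<open>Existence of the lift to a central extension\<close>

lemma lin_ext_hom:
  assumes "lie_algebra s br"
    and "\<And>a b. lin_ext s h (Wt_br_basis a b) = br (h a) (h b)"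
  shows "lie_algebra_hom fscale Wt_br s br (lin_ext s h)"
proof -
  interpret lie_algebra s br by fact
  interpret f: Vector_Spaces.linear fscale s "lin_ext s h"
    by (rule linear_lin_ext) unfold_locales
  have h_basis: "lin_ext s h (basis_vec a) = h a" for a
    by (rule lin_ext_basis_vec) unfold_locales
  have "lin_ext s h (Wt_br x y) = br (lin_ext s h x) (lin_ext s h y)" for x y
  proof (induction x rule: basis_vec_induct)
    case (basis a)
    show ?case
      by (induction y rule: basis_vec_induct)
        (simp_all add: assms(2) h_basis Wt.br_add_right
          Wt.br_scale_right f.add f.scale br_add_right br_scale_right)
  qed (simp_all add: Wt.br_add_left Wt.br_scale_left f.add f.scale br_add_left br_scale_left)
  then show ?thesis by unfold_locales
qed

lemma Wt_proj_lift:
  assumes "lie_central_extension s br fscale W_br \<phi>"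
  shows "\<exists>\<psi>. lie_algebra_hom fscale Wt_br s br \<psi> \<and> \<phi> \<circ> \<psi> = Wt_proj"
proof -
  interpret \<phi>: lie_central_extension s br fscale W_br \<phi> by fact
  define x where "x m = (SOME u. \<phi> u = basis_vec (L m))" for m
  define y where "y m = (SOME u. \<phi> u = basis_vec (I m))" for m
  have x: "\<phi> (x m) = basis_vec (L m)" and y: "\<phi> (y m) = basis_vec (I m)" for m
    unfolding x_def y_def by (rule someI_ex, use \<phi>.surj in \<open>metis surjD\<close>)+
  define K where "K = {u. \<phi> u = 0}"
  have K: "\<phi>.source.subspace K" "K \<subseteq> \<phi>.source.lie_center"
    using \<phi>.kernel_central
    by (auto simp: K_def \<phi>.source.subspace_def \<phi>.add \<phi>.scale)
  have xx: "br (x m) (x n) - s (of_int (m - n)) (x (m + n)) \<in> K"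
    and xy: "br (x m) (y n) - s (of_int (m - n)) (y (m + n)) \<in> K" for m n
    by (simp_all add: K_def \<phi>.diff \<phi>.scale \<phi>.hom_br x y)
  obtain P c1 where P: "\<And>m. P m - x m \<in> K" "c1 \<in> K"
    and xP: "\<And>m n. br (x m) (P n) = s (of_int (m - n)) (P (m + n)) + s (central_coeff m n) c1"
    using witt_module_lift[where x = x and y = x, OF \<phi>.source.lie_algebra_axioms K xx xx] by metis
  obtain Q c2 where Q: "\<And>m. Q m - y m \<in> K" "c2 \<in> K"
    and xQ: "\<And>m n. br (x m) (Q n) = s (of_int (m - n)) (Q (m + n)) + s (central_coeff m n) c2"
    using witt_module_lift[where x = x and y = y, OF \<phi>.source.lie_algebra_axioms K xx xy] by metis
  have \<phi>_lift: "\<phi> (P m) = basis_vec (L m)" "\<phi> (Q m) = basis_vec (I m)" "\<phi> c1 = 0" "\<phi> c2 = 0" for m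
    using P(1)[of m] P(2) Q(1)[of m] Q(2) by (simp_all add: K_def \<phi>.diff x y)
  \<comment> \<open>\<open>witt_module_lift\<close> leaves the acting elements \<open>x m\<close>
    uncorrected; replacing them by \<open>P m\<close> changes them only by central elements.\<close>
  have PP: "br (P m) (P n) = s (of_int (m - n)) (P (m + n)) + s (central_coeff m n) c1"
    and PQ: "br (P m) (Q n) = s (of_int (m - n)) (Q (m + n)) + s (central_coeff m n) c2" for m n
    using \<phi>.source.br_cong_left[OF subsetD[OF K(2) P(1)]] xP xQ by simp_all
  have QP: "br (Q m) (P n) = - (s (of_int (n - m)) (Q (n + m)) + s (central_coeff n m) c2)" for m n
    using \<phi>.source.br_antisym PQ by metis
  have QQ: "br (Q m) (Q n) = 0" for m n
  proof (rule witt_module_lift_abelian[where x = P, OF \<phi>.source.lie_algebra_axioms])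
    show "br (P m) (Q n) - s (of_int (m - n)) (Q (m + n)) \<in> \<phi>.source.lie_center" for m n
      using \<phi>.source.subspace_scale[OF K(1) Q(2)] K(2) by (auto simp: PQ)
    show "br (Q m) (Q n) \<in> \<phi>.source.lie_center" for m n
      by (rule subsetD[OF K(2)]) (simp add: K_def \<phi>.hom_br \<phi>_lift)
  qed
  have c: "br c1 u = 0" "br c2 u = 0" "br u c1 = 0" "br u c2 = 0" for u
    using subsetD[OF K(2) P(2)] subsetD[OF K(2) Q(2)]
    by (simp_all add: \<phi>.source.lie_center_br_left \<phi>.source.lie_center_br_right)
  \<comment> \<open>The relations just obtained for \<open>P\<close>, \<open>Q\<close>,
    \<open>c1\<close>, \<open>c2\<close> are the defining relations of \<open>Wt\<close>, so these
    values on the basis extend to a homomorphism.\<close>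
  define h where "h a = (case a of Lt m \<Rightarrow> P m | It m \<Rightarrow> Q m | C1 \<Rightarrow> c1 | C2 \<Rightarrow> c2)" for a
  interpret \<psi>: Vector_Spaces.linear fscale s "lin_ext s h"
    by (rule linear_lin_ext) unfold_locales
  have basis: "lin_ext s h (basis_vec a) = h a" for a
    by (rule lin_ext_basis_vec) unfold_locales
  have "lin_ext s h (Wt_br_basis a b) = br (h a) (h b)" for a b
    by (cases a; cases b)
      (simp_all add: \<psi>.add \<psi>.scale \<psi>.neg \<psi>.diff basis h_def PP PQ QP QQ c)
  then have "lie_algebra_hom fscale Wt_br s br (lin_ext s h)"
    by (intro lin_ext_hom \<phi>.source.lie_algebra_axioms)
  moreover have "\<phi> \<circ> lin_ext s h = Wt_proj"
  proof (rule linear_eq_basis_vec)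
    show "Vector_Spaces.linear fscale fscale (\<phi> \<circ> lin_ext s h)"
      by (rule Vector_Spaces.linear_compose[OF \<psi>.linear_axioms \<phi>.linear_axioms])
    show "(\<phi> \<circ> lin_ext s h) (basis_vec a) = Wt_proj (basis_vec a)" for a
      by (cases a) (simp_all add: basis h_def \<phi>_lift)
  qed (rule Wt_proj.linear_axioms)
  ultimately show ?thesis by blast
qed

theorem mainTheorem2:
  shows "universal_central_extension TYPE('e::ab_group_add) fscale Wt_br fscale W_br Wt_proj"
  unfolding universal_central_extension_def
proof (intro conjI allI impI ex_ex1I)
  show "lie_covering fscale Wt_br fscale W_br Wt_proj"
    by (rule lie_covering_Wt_proj)
next
  fix s' :: "complex \<Rightarrow> 'e \<Rightarrow> 'e" and b' \<phi>
  assume ext: "lie_central_extension s' b' fscale W_br \<phi>"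
  show "\<exists>\<psi>. lie_algebra_hom fscale Wt_br s' b' \<psi> \<and> \<phi> \<circ> \<psi> = Wt_proj"
    using ext by (rule Wt_proj_lift)
  show "\<psi> = \<chi>"
    if "lie_algebra_hom fscale Wt_br s' b' \<psi> \<and> \<phi> \<circ> \<psi> = Wt_proj"
      and "lie_algebra_hom fscale Wt_br s' b' \<chi> \<and> \<phi> \<circ> \<chi> = Wt_proj" for \<psi> \<chi>
    using lie_algebra_hom_unique[OF Wt_perfect ext] that by metis
qed

end
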